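(* Let $d\ge2$, let $\mathcal{G}$ be a strongly maximal stochastic subgroup of $\mathrm{O}(d^2)$, and let $G$ be its orbital germ. Then $\overline{\mathrm{conv}}(G)$ is the unique qplex $Q$ such that $\mathcal{G}=\mathcal{G}(Q)$.
   Context: Fix an integer $d\ge 2$. $\mathrm{O}(d^2)$ is the group of real orthogonal $d^2\times d^2$ matrices. $\langle\cdot,\cdot\rangle$ is the standard inner product on $\mathbb{R}^{d^2}$, $\|\cdot\|$ the Euclidean norm; $\overline{\mathrm{conv}}$ denotes closed convex hull. $\Delta=\{p\in\mathbb{R}^{d^2}: p(i)\ge0,\ \sum_ip(i)=1\}$; $H=\{u\in\mathbb{R}^{d^2}:\sum_i u(i)=1\}$; $c=(1/d^2,\dots,1/d^2)$. For $A\subseteq H$ the polar is $A^*=\{u\in H:\langle u,v\rangle\ge\frac{1}{d(d+1)}\ \forall v\in A\}$. Out-ball $B_{\rm o}=\{u\in H:\|u-c\|\le r_{\rm o}\}$, $r_{\rm o}^2=\frac{d-1}{d^2(d+1)}$. A qplex is a set $Q\subseteq\Delta\cap B_{\rm o}$ with $Q^*=Q$. A measurement is an array $r(i|j)\ge0$ with $\sum_i r(i|j)=1$ for every $j$; for $q\in Q$, $q_r(i)=\sum_j[(d+1)q(j)-\frac1d]r(i|j)$; it is $Q$-preserving if $\{q_r:q\in Q\}=Q$; its stretched measurement matrix is $R_{ij}=(d+1)r(i|j)-\frac1d\sum_k r(i|k)$. The preservation group $\mathcal{G}(Q)$ is the set of stretched measurement matrices of $Q$-preserving measurements. A subgroup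 $\mathcal{G}\subseteq\mathrm{O}(d^2)$ is stochastic if every $R\in\mathcal{G}$ satisfies $R_{ij}\ge-\frac1d$ for all $i,j$ and $Rc=c$. For a stochastic subgroup $\mathcal{G}$ and $R\in\mathcal{G}$ set $s^R_i(j)=\frac{dR_{ij}+1}{d(d+1)}$; the orbital germ of $\mathcal{G}$ is $G=\{s^R_i: R\in\mathcal{G},\ i=1,\dots,d^2\}$. A stochastic subgroup is maximal if it is not contained in any strictly larger stochastic subgroup, and strongly maximal if it is maximal and $\overline{\mathrm{conv}}$ of its orbital germ is a qplex. *)

theory Defs
  imports "HOL-Analysis.Analysis"
begin

text \<open>Vectors in R^(d^2) are modelled as real^'n with CARD('n) = d^2.\<close>

definition prob_simplex :: "(real^'n) set" where
  "prob_simplex = {p. (\<forall>i. p $ i \<ge> 0) \<and> (\<Sum>i\<in>UNIV. p $ i) = 1}"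

definition hypH :: "(real^'n) set" where
  "hypH = {u. (\<Sum>i\<in>UNIV. u $ i) = 1}"

definition cvec :: "nat \<Rightarrow> real^'n" where
  "cvec d = (\<chi> i. 1 / (real d)^2)"

definition qpolar :: "nat \<Rightarrow> (real^'n) set \<Rightarrow> (real^'n) set" where
  "qpolar d A = {u \<in> hypH. \<forall>v\<in>A. inner u v \<ge> 1 / (real d * (real d + 1))}"

definition out_ball :: "nat \<Rightarrow> (real^'n) set" where
  "out_ball d = {u \<in> hypH. norm (u - cvec d) \<le> sqrt ((real d - 1) / ((real d)^2 * (real d + 1)))}"

definition qplex :: "nat \<Rightarrow> (real^'n) set \<Rightarrow> bool" where
  "qplex d Q \<longleftrightarrow> Q \<subseteq> prob_simplex \<inter> out_ball d \<and> qpolar d Q = Q"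

text \<open>A measurement: r i j stands for r(i|j).\<close>
definition measurement :: "('n \<Rightarrow> 'n \<Rightarrow> real) \<Rightarrow> bool" where
  "measurement r \<longleftrightarrow> (\<forall>i j. r i j \<ge> 0) \<and> (\<forall>j. (\<Sum>i\<in>UNIV. r i j) = 1)"

definition meas_apply :: "nat \<Rightarrow> ('n \<Rightarrow> 'n \<Rightarrow> real) \<Rightarrow> real^'n \<Rightarrow> real^'n" where
  "meas_apply d r q = (\<chi> i. \<Sum>j\<in>UNIV. ((real d + 1) * q $ j - 1 / real d) * r i j)"

definition Q_preserving :: "nat \<Rightarrow> (real^'n) set \<Rightarrow> ('n \<Rightarrow> 'n \<Rightarrow> real) \<Rightarrow> bool" where
  "Q_preserving d Q r \<longleftrightarrow> meas_apply d r ` Q = Q"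

definition stretched :: "nat \<Rightarrow> ('n \<Rightarrow> 'n \<Rightarrow> real) \<Rightarrow> real^'n^'n" where
  "stretched d r = (\<chi> i j. (real d + 1) * r i j - (1 / real d) * (\<Sum>k\<in>UNIV. r i k))"

definition preservation_group :: "nat \<Rightarrow> (real^'n) set \<Rightarrow> (real^'n^'n) set" where
  "preservation_group d Q =
     {R. \<exists>r. measurement r \<and> Q_preserving d Q r \<and> R = stretched d r}"

text \<open>Subgroup of the orthogonal group O(d^2).\<close>
definition orth_subgroup :: "(real^'n^'n) set \<Rightarrow> bool" where
  "orth_subgroup \<G> \<longleftrightarrow> \<G> \<subseteq> {A. orthogonal_matrix A} \<and> mat 1 \<in> \<G> \<and>
     (\<forall>A\<in>\<G>. \<forall>B\<in>\<G>. A ** B \<in> \<G>) \<and> (\<forall>A\<in>\<G>. matrix_inv A \<in> \<G>)"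

definition stochastic_subgroup :: "nat \<Rightarrow> (real^'n^'n) set \<Rightarrow> bool" where
  "stochastic_subgroup d \<G> \<longleftrightarrow> orth_subgroup \<G> \<and>
     (\<forall>R\<in>\<G>. (\<forall>i j. R $ i $ j \<ge> - 1 / real d) \<and> R *v cvec d = cvec d)"

definition orbital_germ :: "nat \<Rightarrow> (real^'n^'n) set \<Rightarrow> (real^'n) set" where
  "orbital_germ d \<G> =
     {(\<chi> j. (real d * R $ i $ j + 1) / (real d * (real d + 1))) | R i. R \<in> \<G>}"

definition maximal_stochastic :: "nat \<Rightarrow> (real^'n^'n) set \<Rightarrow> bool" where
  "maximal_stochastic d \<G> \<longleftrightarrow> stochastic_subgroup d \<G> \<and>
     (\<forall>\<G>'. stochastic_subgroup d \<G>' \<and> \<G> \<subseteq> \<G>' \<longrightarrow> \<G>' = \<G>)"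

definition strongly_maximal :: "nat \<Rightarrow> (real^'n^'n) set \<Rightarrow> bool" where
  "strongly_maximal d \<G> \<longleftrightarrow> maximal_stochastic d \<G> \<and>
     qplex d (closure (convex hull (orbital_germ d \<G>)))"

end

theory Submission
  imports Defs
begin

(*
  Every R in the group permutes its orbital germ G, since R maps the germ of row i of A to the
  germ of row i of A R^T; hence R preserves Q0 = closure (convex hull G). Conversely, the
  orthogonal maps fixing c and preserving Q0 form a stochastic group: their entries are at
  least -1/d because they keep the germs of the identity inside the simplex. By maximality this
  group is the given one.

  A linear map M preserving a qplex Q has nonnegative row sums mu_i, and its i-th row deviates
  from mu_i c by at most (d+1) r_o mu_i (test the self-polarity of Q against c + t (M_i - mu_i c)),
  hence (M q)_i <= mu_i/d on Q and |M_i| <= mu_i. A stretched measurement matrix has column sums 1,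
  and points of Q with q_i = 1/d force every mu_i = 1; then M and its inverse have rows of length
  at most 1, which makes M orthogonal. So the preservation group of Q0 is again the given group.

  Finally, if the group is the preservation group of a qplex Q, then G lies in the polar of Q,
  which is Q; so Q0 is contained in Q, and self-polarity gives Q = Q^* <= Q0^* = Q0.
*)

lemma cvec_nth [simp]: "cvec d $ i = 1 / (real d)^2"
  by (simp add: cvec_def)

lemma inner_cvec_left: "inner (cvec d) u = (\<Sum>i\<in>UNIV. u $ i) / (real d)^2"
  by (simp add: inner_vec_def sum_divide_distrib)

lemma inner_cvec_hypH: "u \<in> hypH \<Longrightarrow> inner (cvec d) u = 1 / (real d)^2"
  by (simp add: inner_cvec_left hypH_def)

lemma hypH_iff_inner_cvec:
  "d > 0 \<Longrightarrow> u \<in> hypH \<longleftrightarrow> inner (cvec d) u = 1 / (real d)^2"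
  by (auto simp: hypH_def inner_cvec_left)

lemma cvec_in_hypH: "CARD('n) = d^2 \<Longrightarrow> d > 0 \<Longrightarrow> (cvec d :: real^'n) \<in> hypH"
  by (simp add: hypH_def)

lemma orthogonal_cvec_centered:
  assumes "CARD('n) = d^2" "d > 0"
  shows "orthogonal (cvec d) (x - (\<Sum>j\<in>UNIV. x $ j) *\<^sub>R cvec d :: real^'n)"
  using inner_cvec_hypH[OF cvec_in_hypH[OF assms]]
  by (simp add: orthogonal_def inner_diff_right inner_cvec_left[of d x])

lemma matrix_vector_mult_cvec_nth:
  "(M *v cvec d) $ i = (\<Sum>j\<in>UNIV. M $ i $ j) / (real d)^2"
  by (simp add: matrix_vector_mult_def sum_divide_distrib)

lemma row_sum_eq_one_if_fixes_cvec:
  assumes "d > 0" "M *v cvec d = cvec d"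
  shows "(\<Sum>j\<in>UNIV. M $ i $ j) = 1"
  using arg_cong[OF assms(2), of "\<lambda>v. v $ i"] assms(1) by (simp add: matrix_vector_mult_cvec_nth)

lemma col_sum_eq_one_if_fixes_cvec:
  assumes "d > 0" "M *v cvec d = cvec d" "orthogonal_matrix M"
  shows "(\<Sum>i\<in>UNIV. M $ i $ j) = 1"
proof -
  have "transpose M *v cvec d = transpose M *v (M *v cvec d)" using assms(2) by simp
  also have "\<dots> = cvec d"
    using assms(3) by (simp add: matrix_vector_mul_assoc orthogonal_matrix_def)
  finally have "transpose M *v cvec d = cvec d" .
  from row_sum_eq_one_if_fixes_cvec[OF assms(1) this] show ?thesis
    by (simp add: transpose_def)
qed

lemma matrix_inv_orthogonal:
  assumes "orthogonal_matrix (R :: real^'n^'n)"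
  shows "matrix_inv R = transpose R"
proof -
  have "R ** transpose R = mat 1 \<and> transpose R ** R = mat 1"
    using assms by (simp add: orthogonal_matrix_def)
  then have "R ** matrix_inv R = mat 1"
    unfolding matrix_inv_def by (rule someI2) simp
  then have "transpose R ** (R ** matrix_inv R) = transpose R"
    by simp
  then show ?thesis using assms by (simp add: matrix_mul_assoc orthogonal_matrix_def)
qed

lemma qpolar_eq_Int_halfspaces:
  "qpolar d A = {u. inner (\<chi> i. 1) u = 1} \<inter> (\<Inter>v\<in>A. {u. inner v u \<ge> 1 / (real d * (real d + 1))})"
  by (auto simp: qpolar_def hypH_def inner_vec_def mult.commute)

lemma closed_qpolar: "closed (qpolar d A)"
  unfolding qpolar_eq_Int_halfspaces
  by (intro closed_Int closed_hyperplane closed_INT ballI closed_halfspace_ge)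

lemma convex_qpolar: "convex (qpolar d A)"
  unfolding qpolar_eq_Int_halfspaces
  by (intro convex_Int convex_hyperplane convex_INT convex_halfspace_ge)

lemma qpolar_antimono: "A \<subseteq> B \<Longrightarrow> qpolar d B \<subseteq> qpolar d A"
  by (auto simp: qpolar_def)

definition out_radius :: "nat \<Rightarrow> real" where
  "out_radius d = sqrt ((real d - 1) / ((real d)^2 * (real d + 1)))"

lemma out_radius_pos: "d \<ge> 2 \<Longrightarrow> out_radius d > 0"
  by (simp add: out_radius_def)

lemma out_radius_sq_identities:
  assumes "d \<ge> 2"
  shows "(real d + 1) * (out_radius d)^2 + 1 / (real d)^2 = 1 / real d"
    and "((real d + 1) * out_radius d)^2 + 1 / (real d)^2 = 1"
proof -
  define D where "D = real d"
  have D: "D \<ge> 2" using assms by (simp add: D_def)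
  have ro2: "(out_radius d)^2 = (D - 1) / (D^2 * (D + 1))"
    using assms by (simp add: out_radius_def D_def)
  show "(real d + 1) * (out_radius d)^2 + 1 / (real d)^2 = 1 / real d"
    unfolding ro2 D_def[symmetric]
    using D by (simp add: divide_simps) (simp add: algebra_simps power2_eq_square)
  show "((real d + 1) * out_radius d)^2 + 1 / (real d)^2 = 1"
    unfolding power_mult_distrib ro2 D_def[symmetric]
    using D by (simp add: divide_simps) (simp add: algebra_simps power2_eq_square)
qed

lemma qplex_subset_hypH: "qplex d Q \<Longrightarrow> Q \<subseteq> hypH"
  by (auto simp: qplex_def out_ball_def)

lemma qplex_nonneg: "qplex d Q \<Longrightarrow> q \<in> Q \<Longrightarrow> q $ i \<ge> 0"
  by (auto simp: qplex_def prob_simplex_def)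

lemma qplex_dist_cvec_le: "qplex d Q \<Longrightarrow> q \<in> Q \<Longrightarrow> norm (q - cvec d) \<le> out_radius d"
  by (auto simp: qplex_def out_ball_def out_radius_def)

lemma qplex_polarI:
  assumes "qplex d Q" "u \<in> hypH" "\<And>v. v \<in> Q \<Longrightarrow> inner u v \<ge> 1 / (real d * (real d + 1))"
  shows "u \<in> Q"
  using assms by (auto simp: qplex_def qpolar_def)

lemma cvec_in_qplex:
  assumes "CARD('n) = d^2" "d > 0" "qplex d (Q :: (real^'n) set)"
  shows "cvec d \<in> Q"
proof (rule qplex_polarI[OF assms(3) cvec_in_hypH[OF assms(1,2)]])
  fix v assume "v \<in> Q"
  then have "inner (cvec d) v = 1 / (real d)^2"
    using qplex_subset_hypH[OF assms(3)] inner_cvec_hypH by blast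
  moreover have "1 / (real d * (real d + 1)) \<le> 1 / (real d)^2"
    using assms(2) by (simp add: power2_eq_square frac_le)
  ultimately show "1 / (real d * (real d + 1)) \<le> inner (cvec d) v" by simp
qed

context
  fixes d :: nat and Q :: "(real^'n) set" and M :: "real^'n^'n" and i :: 'n
  assumes card: "CARD('n) = d^2" and d2: "d \<ge> 2" and qplex: "qplex d Q"
    and maps_into: "\<And>y. y \<in> Q \<Longrightarrow> M *v y \<in> Q"
begin

lemma qplex_row_sum_nonneg: "0 \<le> (\<Sum>j\<in>UNIV. M $ i $ j)"
proof -
  have "0 \<le> (M *v cvec d) $ i"
    using qplex_nonneg[OF qplex maps_into[OF cvec_in_qplex[OF card _ qplex]]] d2 by simp
  then show ?thesis using d2 by (simp add: matrix_vector_mult_cvec_nth zero_le_divide_iff)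
qed

\<comment> \<open>nonnegativity of the i-th coordinate of M v puts this probe into the polar of Q\<close>
lemma qplex_row_probe_in_qplex:
  assumes t: "t \<ge> 0" and small: "(real d + 1) * t * (\<Sum>j\<in>UNIV. M $ i $ j) \<le> 1"
  shows "cvec d + t *\<^sub>R (M $ i - (\<Sum>j\<in>UNIV. M $ i $ j) *\<^sub>R cvec d) \<in> Q"
proof -
  define D where "D = real d"
  define mu where "mu = (\<Sum>j\<in>UNIV. M $ i $ j)"
  define c where "c = (cvec d :: real^'n)"
  define u where "u = c + t *\<^sub>R (M $ i - mu *\<^sub>R c)"
  have D: "D \<ge> 2" using d2 by (simp add: D_def)
  have c_hyp: "c \<in> hypH" using cvec_in_hypH[OF card] d2 by (simp add: c_def)
  have inner_c_Q: "inner c y = 1 / D^2" if "y \<in> Q" for y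
    using qplex_subset_hypH[OF qplex] that inner_cvec_hypH by (auto simp: c_def D_def)
  have "inner c (M $ i - mu *\<^sub>R c) = 0"
    using orthogonal_cvec_centered[OF card, of "M $ i"] d2 by (simp add: orthogonal_def c_def mu_def)
  then have "u \<in> hypH"
    using hypH_iff_inner_cvec[of d u] inner_cvec_hypH[OF c_hyp] d2
    by (simp add: u_def c_def inner_add_right)
  moreover have "inner u v \<ge> 1 / (real d * (real d + 1))" if v: "v \<in> Q" for v
  proof -
    have "t * mu \<le> 1 / (D + 1)"
      using small D by (simp add: mu_def D_def pos_le_divide_eq mult.commute mult.left_commute)
    then have "t * mu / D^2 \<le> 1 / (D + 1) / D^2" by (rule divide_right_mono) simp
    have "(M *v v) $ i \<ge> 0" using qplex_nonneg[OF qplex maps_into[OF v]] .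
    then have "t * ((M *v v) $ i - mu / D^2) \<ge> - (t * mu / D^2)"
      using t by (simp add: algebra_simps)
    also have "- (t * mu / D^2) \<ge> - (1 / (D + 1) / D^2)"
      using \<open>t * mu / D^2 \<le> 1 / (D + 1) / D^2\<close> by simp
    finally have "inner u v \<ge> 1 / D^2 - 1 / (D + 1) / D^2"
      using inner_c_Q[OF v] by (simp add: u_def inner_add_left inner_diff_left matrix_vector_mul_component)
    also have "1 / D^2 - 1 / (D + 1) / D^2 = 1 / (D * (D + 1))"
      using D by (simp add: divide_simps) (simp add: algebra_simps power2_eq_square)
    finally show ?thesis by (simp add: D_def)
  qed
  ultimately show ?thesis using qplex_polarI[OF qplex] by (simp add: u_def c_def mu_def)
qed

lemma qplex_row_deviation_le:
  "norm (M $ i - (\<Sum>j\<in>UNIV. M $ i $ j) *\<^sub>R cvec d)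
     \<le> (real d + 1) * out_radius d * (\<Sum>j\<in>UNIV. M $ i $ j)"
proof -
  define mu where "mu = (\<Sum>j\<in>UNIV. M $ i $ j)"
  define z where "z = M $ i - mu *\<^sub>R cvec d"
  define K where "K = (real d + 1) * out_radius d"
  have mu: "mu \<ge> 0" using qplex_row_sum_nonneg by (simp add: mu_def)
  have K: "K > 0" using out_radius_pos[OF d2] by (simp add: K_def)
  have bound: "norm z \<le> K * (mu + l)" if l: "l > 0" for l
  proof -
    define t where "t = 1 / ((real d + 1) * (mu + l))"
    have pos: "(real d + 1) * (mu + l) > 0" using mu l by simp
    have "(real d + 1) * t * mu \<le> 1"
      using mu l by (simp add: t_def pos_divide_le_eq mult.commute mult.left_commute)
    from qplex_row_probe_in_qplex[OF _ this[unfolded mu_def]] pos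
    have "t * norm z \<le> out_radius d"
      using qplex_dist_cvec_le[OF qplex] by (fastforce simp: t_def z_def mu_def)
    then have "norm z / ((real d + 1) * (mu + l)) \<le> out_radius d" by (simp add: t_def)
    with pos show ?thesis by (simp add: K_def pos_divide_le_eq algebra_simps)
  qed
  have "norm z \<le> K * mu"
  proof (rule field_le_epsilon)
    fix e :: real assume "e > 0"
    then show "norm z \<le> K * mu + e" using bound[of "e / K"] K by (simp add: distrib_left)
  qed
  then show ?thesis by (simp add: z_def mu_def K_def)
qed

lemma qplex_row_image_le:
  assumes "y \<in> Q"
  shows "(M *v y) $ i \<le> (\<Sum>j\<in>UNIV. M $ i $ j) / real d"
proof -
  define D where "D = real d"
  define mu where "mu = (\<Sum>j\<in>UNIV. M $ i $ j)"
  define c where "c = (cvec d :: real^'n)"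
  define z where "z = M $ i - mu *\<^sub>R c"
  have D: "D \<ge> 2" using d2 by (simp add: D_def)
  have mu: "mu \<ge> 0" using qplex_row_sum_nonneg by (simp add: mu_def)
  have z: "norm z \<le> (D + 1) * out_radius d * mu"
    using qplex_row_deviation_le by (simp add: z_def mu_def c_def D_def)
  have "inner z c = 0"
    using orthogonal_cvec_centered[OF card, of "M $ i"] d2
    by (simp add: orthogonal_def inner_commute z_def c_def mu_def)
  then have "(M *v y) $ i = inner z (y - c) + mu * inner c y"
    by (simp add: matrix_vector_mul_component z_def inner_diff_left inner_diff_right)
  also have "inner c y = 1 / D^2"
    using qplex_subset_hypH[OF qplex] assms inner_cvec_hypH by (auto simp: c_def D_def)
  also have "inner z (y - c) \<le> norm z * norm (y - c)" by (rule norm_cauchy_schwarz)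
  also have "\<dots> \<le> ((D + 1) * out_radius d * mu) * out_radius d"
    using z qplex_dist_cvec_le[OF qplex assms] D mu out_radius_pos[OF d2]
    by (intro mult_mono) (auto simp: c_def)
  also have "\<dots> = (D + 1) * (out_radius d)^2 * mu" by (simp add: power2_eq_square)
  also have "\<dots> + mu * (1 / D^2) = mu * ((D + 1) * (out_radius d)^2 + 1 / D^2)"
    by (simp add: algebra_simps)
  also have "\<dots> = mu / D" using out_radius_sq_identities(1)[OF d2] by (simp add: D_def)
  finally show ?thesis by (simp add: mu_def D_def)
qed

lemma qplex_row_norm_le: "norm (M $ i) \<le> (\<Sum>j\<in>UNIV. M $ i $ j)"
proof -
  define D where "D = real d"
  define mu where "mu = (\<Sum>j\<in>UNIV. M $ i $ j)"
  define c where "c = (cvec d :: real^'n)"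
  define z where "z = M $ i - mu *\<^sub>R c"
  have mu: "mu \<ge> 0" using qplex_row_sum_nonneg by (simp add: mu_def)
  have z: "norm z \<le> (D + 1) * out_radius d * mu"
    using qplex_row_deviation_le by (simp add: z_def mu_def c_def D_def)
  have "orthogonal z (mu *\<^sub>R c)"
    using orthogonal_cvec_centered[OF card, of "M $ i"] d2
    by (simp add: orthogonal_def inner_commute z_def c_def mu_def)
  then have "(norm (z + mu *\<^sub>R c))^2 = (norm z)^2 + (norm (mu *\<^sub>R c))^2"
    by (rule norm_add_Pythagorean)
  then have "(norm (M $ i))^2 = (norm z)^2 + mu^2 * inner c c"
    by (simp add: z_def power_mult_distrib power2_norm_eq_inner[symmetric])
  also have "inner c c = 1 / D^2"
    using inner_cvec_hypH[OF cvec_in_hypH[OF card]] d2 by (simp add: c_def D_def)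
  also have "(norm z)^2 \<le> ((D + 1) * out_radius d * mu)^2"
    using z by (intro power_mono) auto
  also have "((D + 1) * out_radius d * mu)^2 + mu^2 * (1 / D^2)
      = mu^2 * (((D + 1) * out_radius d)^2 + 1 / D^2)"
    by algebra
  also have "\<dots> = mu^2" using out_radius_sq_identities(2)[OF d2] by (simp add: D_def)
  finally have "(norm (M $ i))^2 \<le> mu^2" by simp
  from power2_le_imp_le[OF this mu] show ?thesis by (simp add: mu_def)
qed

end

lemma orthogonal_matrix_if_inverse_rows_le_one:
  fixes M S :: "real^'n^'n"
  assumes MS: "M ** S = mat 1"
    and M_rows: "\<And>i. norm (M $ i) \<le> 1" and S_rows: "\<And>i. norm (S $ i) \<le> 1"
  shows "orthogonal_matrix M"
proof -
  have row_sq: "(\<Sum>j\<in>UNIV. (A $ i $ j)^2) \<le> 1" if "norm (A $ i) \<le> 1" for A :: "real^'n^'n" and i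
  proof -
    have "(\<Sum>j\<in>UNIV. (A $ i $ j)^2) = (norm (A $ i))^2"
      unfolding power2_norm_eq_inner by (simp add: inner_vec_def power2_eq_square)
    also have "\<dots> \<le> 1" by (rule power_le_one[OF norm_ge_zero that])
    finally show ?thesis .
  qed
  have trace: "(\<Sum>j\<in>UNIV. M $ i $ j * S $ j $ i) = 1" for i
    using arg_cong[OF MS, of "\<lambda>A. A $ i $ i"] by (simp add: matrix_matrix_mult_def mat_def)
  \<comment> \<open>the squared Frobenius distance between M and the transpose of S is at most n + n - 2 tr(M S) = 0\<close>
  have "(\<Sum>i\<in>UNIV. \<Sum>j\<in>UNIV. (M $ i $ j - S $ j $ i)^2)
      = (\<Sum>i\<in>UNIV. \<Sum>j\<in>UNIV. (M $ i $ j)^2) + (\<Sum>i\<in>UNIV. \<Sum>j\<in>UNIV. (S $ j $ i)^2)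
        - 2 * (\<Sum>i\<in>UNIV. \<Sum>j\<in>UNIV. M $ i $ j * S $ j $ i)"
    by (simp only: power2_diff sum.distrib sum_subtractf sum_distrib_left mult.assoc)
  also have "(\<Sum>i\<in>UNIV. \<Sum>j\<in>UNIV. (S $ j $ i)^2) = (\<Sum>j\<in>UNIV. \<Sum>i\<in>UNIV. (S $ j $ i)^2)"
    by (rule sum.swap)
  also have "(\<Sum>i\<in>UNIV. \<Sum>j\<in>UNIV. (M $ i $ j)^2) + \<dots>
        - 2 * (\<Sum>i\<in>UNIV. \<Sum>j\<in>UNIV. M $ i $ j * S $ j $ i) \<le> 0"
    using sum_mono[of UNIV "\<lambda>i. \<Sum>j\<in>UNIV. (M $ i $ j)^2" "\<lambda>_. 1", OF row_sq[OF M_rows]]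
      sum_mono[of UNIV "\<lambda>j. \<Sum>i\<in>UNIV. (S $ j $ i)^2" "\<lambda>_. 1", OF row_sq[OF S_rows]]
    by (simp add: trace)
  finally have "(\<Sum>i\<in>UNIV. \<Sum>j\<in>UNIV. (M $ i $ j - S $ j $ i)^2) = 0"
    by (intro antisym sum_nonneg) auto
  then have "M $ i $ j - S $ j $ i = 0" for i j
    by (simp add: sum_nonneg_eq_0_iff sum_nonneg)
  then have "S = transpose M" by (simp add: vec_eq_iff transpose_def)
  then show ?thesis
    using MS matrix_left_right_inverse by (auto simp: orthogonal_matrix_def)
qed

lemma surj_matrix_vector_mult_if_image_spanning:
  fixes M :: "real^'n^'n"
  assumes "(*v) M ` Q = Q" "span Q = UNIV"
  shows "surj ((*v) M)"
proof -
  have "span Q \<subseteq> range ((*v) M)"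
    using assms(1) by (intro span_minimal subspace_UNIV[THEN linear_subspace_image[OF matrix_vector_mul_linear]]) auto
  then show ?thesis using assms(2) by auto
qed

lemma qplex_preserving_orthogonal:
  fixes M :: "real^'n^'n" and Q :: "(real^'n) set"
  assumes card: "CARD('n) = d^2" and d2: "d \<ge> 2" and qplex: "qplex d Q"
    and image: "(*v) M ` Q = Q"
    and col_sums: "\<And>j. (\<Sum>i\<in>UNIV. M $ i $ j) = 1"
    and peaks: "\<And>i. \<exists>q\<in>Q. q $ i = 1 / real d"
    and spanning: "span Q = UNIV"
  shows "orthogonal_matrix M" and "M *v cvec d = cvec d"
proof -
  have maps_into: "M *v y \<in> Q" if "y \<in> Q" for y using image that by blast
  \<comment> \<open>a preimage of a point of Q with i-th coordinate 1/d forces the i-th row sum to be at least 1\<close>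
  have row_sums_ge: "(\<Sum>j\<in>UNIV. M $ i $ j) \<ge> 1" for i
  proof -
    obtain x where "x \<in> Q" "(M *v x) $ i = 1 / real d"
      using peaks[of i] image by (metis imageE)
    then show ?thesis
      using qplex_row_image_le[OF card d2 qplex maps_into, of x i] d2 by (simp add: divide_le_cancel)
  qed
  have "(\<Sum>i\<in>UNIV. (\<Sum>j\<in>UNIV. M $ i $ j) - 1) = 0"
    using col_sums by (simp add: sum_subtractf sum.swap[of _ UNIV UNIV])
  then have row_sums: "(\<Sum>j\<in>UNIV. M $ i $ j) = 1" for i
    using row_sums_ge by (simp add: sum_nonneg_eq_0_iff)
  then show fixes_cvec: "M *v cvec d = cvec d"
    by (simp add: vec_eq_iff matrix_vector_mult_cvec_nth)
  obtain S where MS: "M ** S = mat 1"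
    using surj_matrix_vector_mult_if_image_spanning[OF image spanning]
      matrix_right_invertible_surjective[of M] by blast
  then have SM: "S ** M = mat 1" by (rule matrix_left_right_inverse[THEN iffD1])
  have S_maps_into: "S *v y \<in> Q" if "y \<in> Q" for y
  proof -
    obtain x where "x \<in> Q" "y = M *v x" using image \<open>y \<in> Q\<close> by blast
    then show ?thesis by (simp add: matrix_vector_mul_assoc SM)
  qed
  have "S *v cvec d = cvec d"
    using arg_cong[OF fixes_cvec, of "(*v) S"] by (simp add: matrix_vector_mul_assoc SM)
  then have S_row_sums: "(\<Sum>j\<in>UNIV. S $ i $ j) = 1" for i
    using d2 by (intro row_sum_eq_one_if_fixes_cvec) auto
  have "norm (M $ i) \<le> 1" "norm (S $ i) \<le> 1" for i
    using qplex_row_norm_le[OF card d2 qplex, of M i] qplex_row_norm_le[OF card d2 qplex, of S i]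
      maps_into S_maps_into row_sums S_row_sums by simp_all
  with MS show "orthogonal_matrix M" by (rule orthogonal_matrix_if_inverse_rows_le_one)
qed

lemma meas_apply_eq_stretched:
  assumes "q \<in> hypH"
  shows "meas_apply d r q = stretched d r *v q"
proof -
  have "(\<Sum>j\<in>UNIV. ((real d + 1) * q $ j - 1 / real d) * r i j)
      = (\<Sum>j\<in>UNIV. ((real d + 1) * r i j - 1 / real d * (\<Sum>k\<in>UNIV. r i k)) * q $ j)" for i
  proof -
    have "(\<Sum>j\<in>UNIV. ((real d + 1) * q $ j - 1 / real d) * r i j)
        = (real d + 1) * (\<Sum>j\<in>UNIV. r i j * q $ j) - 1 / real d * (\<Sum>j\<in>UNIV. r i j)"
      by (simp add: algebra_simps sum_subtractf sum_distrib_left sum_divide_distrib)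
    moreover have "(\<Sum>j\<in>UNIV. ((real d + 1) * r i j - 1 / real d * (\<Sum>k\<in>UNIV. r i k)) * q $ j)
        = (real d + 1) * (\<Sum>j\<in>UNIV. r i j * q $ j)
          - 1 / real d * (\<Sum>k\<in>UNIV. r i k) * (\<Sum>j\<in>UNIV. q $ j)"
      by (simp add: algebra_simps sum_subtractf sum_distrib_left sum_divide_distrib) (rule sum.swap)
    ultimately show ?thesis using assms by (simp add: hypH_def)
  qed
  then show ?thesis
    by (simp add: vec_eq_iff meas_apply_def stretched_def matrix_vector_mult_def)
qed

lemma col_sum_stretched:
  assumes "CARD('n) = d^2" "d > 0" "measurement (r :: 'n::finite \<Rightarrow> 'n \<Rightarrow> real)"
  shows "(\<Sum>i\<in>UNIV. stretched d r $ i $ j) = 1"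
proof -
  have col: "(\<Sum>i\<in>UNIV. r i j) = 1" for j using assms(3) by (simp add: measurement_def)
  have "(\<Sum>i\<in>UNIV. stretched d r $ i $ j)
      = (real d + 1) * (\<Sum>i\<in>UNIV. r i j) - 1 / real d * (\<Sum>i\<in>UNIV. \<Sum>k\<in>UNIV. r i k)"
    by (simp add: stretched_def sum_subtractf sum_distrib_left)
  also have "(\<Sum>i\<in>UNIV. \<Sum>k\<in>UNIV. r i k) = (\<Sum>k\<in>UNIV. \<Sum>i\<in>UNIV. r i k)" by (rule sum.swap)
  finally show ?thesis using col assms(1,2) by (simp add: power2_eq_square)
qed

lemma stretched_measurement_exists:
  fixes M :: "real^'n^'n"
  assumes "CARD('n) = d^2" "d > 0"
    and row_sums: "\<And>i. (\<Sum>j\<in>UNIV. M $ i $ j) = 1"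
    and col_sums: "\<And>j. (\<Sum>i\<in>UNIV. M $ i $ j) = 1"
    and entries: "\<And>i j. M $ i $ j \<ge> - 1 / real d"
  shows "\<exists>r. measurement r \<and> stretched d r = M"
proof (intro exI conjI)
  define r where "r i j = (M $ i $ j + 1 / real d) / (real d + 1)" for i j
  have sum_r: "(\<Sum>k\<in>UNIV. r i k) = ((\<Sum>k\<in>UNIV. M $ i $ k) + real d) / (real d + 1)"
    and sum_r': "(\<Sum>k\<in>UNIV. r k j) = ((\<Sum>k\<in>UNIV. M $ k $ j) + real d) / (real d + 1)" for i j
    using assms(1,2) by (simp_all add: r_def sum_divide_distrib[symmetric] sum.distrib power2_eq_square)
  have "r i j \<ge> 0" for i j
    using entries[of i j] by (simp add: r_def)
  then show "measurement r"
    unfolding measurement_def using assms(2) by (simp add: sum_r' col_sums)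
  have "(\<Sum>k\<in>UNIV. r i k) = 1" "(real d + 1) * r i j = M $ i $ j + 1 / real d" for i j
    by (simp add: sum_r row_sums add_pos_pos) (simp add: r_def add_pos_pos)
  then show "stretched d r = M" by (simp add: stretched_def vec_eq_iff)
qed

lemma preservation_group_iff:
  assumes "Q \<subseteq> hypH"
  shows "R \<in> preservation_group d Q \<longleftrightarrow>
    (\<exists>r. measurement r \<and> stretched d r = R) \<and> (*v) R ` Q = Q"
proof -
  have "meas_apply d r ` Q = (*v) (stretched d r) ` Q" for r
    using assms meas_apply_eq_stretched by (intro image_cong) auto
  then show ?thesis by (auto simp: preservation_group_def Q_preserving_def)
qed

definition unit_germ :: "nat \<Rightarrow> 'n \<Rightarrow> real^'n" where
  "unit_germ d j = (\<chi> k. if k = j then 1 / real d else 1 / (real d * (real d + 1)))"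

lemma unit_germ_eq_germ_of_mat_1:
  "d > 0 \<Longrightarrow> unit_germ d j = (\<chi> k. (real d * (mat 1 :: real^'n^'n) $ j $ k + 1) / (real d * (real d + 1)))"
  by (simp add: unit_germ_def mat_def vec_eq_iff)

lemma unit_germ_in_orbital_germ:
  "d > 0 \<Longrightarrow> mat 1 \<in> \<G> \<Longrightarrow> unit_germ d j \<in> orbital_germ d \<G>"
  unfolding orbital_germ_def unit_germ_eq_germ_of_mat_1 by blast

lemma span_unit_germs:
  assumes "d > 0"
  shows "span (insert (cvec d) (range (unit_germ d))) = (UNIV :: (real^'n) set)"
proof -
  have "axis j 1 = (real d + 1) *\<^sub>R unit_germ d j - real d *\<^sub>R cvec d" for j :: 'n
    using assms by (simp add: vec_eq_iff axis_def unit_germ_def power2_eq_square diff_divide_distrib[symmetric])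
  then have "axis j 1 \<in> span (insert (cvec d) (range (unit_germ d)))" for j :: 'n
    by (metis span_diff span_scale span_base insertI1 insertI2 rangeI)
  then have "x \<in> span (insert (cvec d) (range (unit_germ d)))" for x :: "real^'n"
    using basis_expansion[of x] by (metis (no_types, lifting) span_sum span_mul scalar_mult_eq_scaleR)
  then show ?thesis by auto
qed

lemma inner_germ:
  fixes D E :: real
  shows "inner (\<chi> j. (D * R $ i $ j + 1) / E) v = (D * (R *v v) $ i + (\<Sum>j\<in>UNIV. v $ j)) / E"
  by (simp add: inner_vec_def matrix_vector_mult_def sum_divide_distrib[symmetric] sum.distrib
      sum_distrib_left algebra_simps)

lemma matrix_vector_mult_germ:
  fixes D E :: real
  shows "M *v (\<chi> j. (D * A $ i $ j + 1) / E)
     = (\<chi> k. (D * (A ** transpose M) $ i $ k + (\<Sum>j\<in>UNIV. M $ k $ j)) / E)"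
  using inner_germ[of D A i E]
  by (simp add: vec_eq_iff matrix_vector_mul_component matrix_matrix_mult_def transpose_def
      inner_commute inner_vec_def mult.commute)

lemma stochastic_subgroupD:
  assumes "stochastic_subgroup d \<G>" "R \<in> \<G>"
  shows "orthogonal_matrix R" "R *v cvec d = cvec d" "transpose R \<in> \<G>"
    and "S \<in> \<G> \<Longrightarrow> R ** S \<in> \<G>"
proof -
  have group: "orth_subgroup \<G>" and "R *v cvec d = cvec d"
    using assms by (simp_all add: stochastic_subgroup_def)
  then show "R *v cvec d = cvec d" "S \<in> \<G> \<Longrightarrow> R ** S \<in> \<G>"
    using assms(2) by (simp_all add: orth_subgroup_def)
  show orth: "orthogonal_matrix R" using group assms(2) by (auto simp: orth_subgroup_def)
  have "matrix_inv R \<in> \<G>" using group assms(2) by (simp add: orth_subgroup_def)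
  then show "transpose R \<in> \<G>" by (simp add: matrix_inv_orthogonal[OF orth])
qed

lemma orbital_germ_invariant:
  assumes "stochastic_subgroup d \<G>" "d > 0" "R \<in> \<G>"
  shows "(*v) R ` orbital_germ d \<G> \<subseteq> orbital_germ d \<G>"
proof
  fix y assume "y \<in> (*v) R ` orbital_germ d \<G>"
  then obtain A i where A: "A \<in> \<G>"
    and y: "y = R *v (\<chi> j. (real d * A $ i $ j + 1) / (real d * (real d + 1)))"
    by (auto simp: orbital_germ_def)
  have "A ** transpose R \<in> \<G>"
    using stochastic_subgroupD(4)[OF assms(1) A stochastic_subgroupD(3)[OF assms(1,3)]] .
  moreover have "y = (\<chi> k. (real d * (A ** transpose R) $ i $ k + 1) / (real d * (real d + 1)))"
    using row_sum_eq_one_if_fixes_cvec[OF assms(2) stochastic_subgroupD(2)[OF assms(1,3)]]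
    by (simp add: y matrix_vector_mult_germ)
  ultimately show "y \<in> orbital_germ d \<G>" unfolding orbital_germ_def by blast
qed

lemma closed_hull_orbital_germ_invariant:
  assumes "stochastic_subgroup d \<G>" "d > 0" "R \<in> \<G>"
  shows "(*v) R ` closure (convex hull orbital_germ d \<G>) = closure (convex hull orbital_germ d \<G>)"
    (is "_ ` ?Q = ?Q")
proof -
  have into: "(*v) A ` ?Q \<subseteq> ?Q" if "A \<in> \<G>" for A
  proof -
    have "(*v) A ` ?Q \<subseteq> closure ((*v) A ` (convex hull orbital_germ d \<G>))"
      by (rule closure_linear_image_subset) simp
    also have "\<dots> = closure (convex hull ((*v) A ` orbital_germ d \<G>))"
      by (simp add: convex_hull_linear_image)
    also have "\<dots> \<subseteq> ?Q"
      using orbital_germ_invariant[OF assms(1,2) that] by (intro closure_mono hull_mono)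
    finally show ?thesis .
  qed
  have "R ** transpose R = mat 1"
    using stochastic_subgroupD(1)[OF assms(1,3)] by (simp add: orthogonal_matrix_def)
  then have "R *v (transpose R *v x) = x" for x
    by (simp only: matrix_vector_mul_assoc matrix_vector_mul_lid)
  then have "?Q = (*v) R ` ((*v) (transpose R) ` ?Q)" by (simp add: image_image)
  also have "\<dots> \<subseteq> (*v) R ` ?Q"
    using into[OF stochastic_subgroupD(3)[OF assms(1,3)]] by (rule image_mono)
  finally show ?thesis using into[OF assms(3)] by blast
qed

definition qplex_symmetries :: "nat \<Rightarrow> (real^'n) set \<Rightarrow> (real^'n^'n) set" where
  "qplex_symmetries d Q = {M. orthogonal_matrix M \<and> M *v cvec d = cvec d \<and> (*v) M ` Q = Q}"

lemma transpose_in_qplex_symmetries: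
  assumes "M \<in> qplex_symmetries d Q"
  shows "transpose M \<in> qplex_symmetries d Q"
proof -
  have orth: "orthogonal_matrix M" and fix_c: "M *v cvec d = cvec d" and image: "(*v) M ` Q = Q"
    using assms by (simp_all add: qplex_symmetries_def)
  have "transpose M *v (M *v x) = x" for x
    using orth by (simp only: matrix_vector_mul_assoc orthogonal_matrix matrix_vector_mul_lid)
  then have "(*v) (transpose M) ` ((*v) M ` Q) = Q" "transpose M *v (M *v cvec d) = cvec d"
    by (simp_all add: image_image)
  then show ?thesis using orth fix_c image by (simp add: qplex_symmetries_def)
qed

lemma qplex_symmetry_entry_ge:
  assumes "qplex d Q" "d > 0" "unit_germ d j \<in> Q" "M \<in> qplex_symmetries d Q"
  shows "M $ i $ j \<ge> - 1 / real d"
proof -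
  have "M *v cvec d = cvec d" "M *v unit_germ d j \<in> Q"
    using assms(3,4) by (auto simp: qplex_symmetries_def)
  then have "0 \<le> (real d * M $ i $ j + 1) / (real d * (real d + 1))"
    using qplex_nonneg[OF assms(1)] row_sum_eq_one_if_fixes_cvec[OF assms(2)]
    by (force simp: unit_germ_eq_germ_of_mat_1[OF assms(2)] matrix_vector_mult_germ transpose_def)
  moreover have pos: "real d * (real d + 1) > 0" using assms(2) by simp
  ultimately have "- 1 \<le> real d * M $ i $ j" using pos_le_divide_eq[OF pos, of 0] by simp
  then show ?thesis using assms(2) by (simp add: pos_minus_divide_le_eq mult.commute)
qed

lemma stochastic_subgroup_qplex_symmetries:
  assumes "qplex d Q" "d > 0" "\<And>j. unit_germ d j \<in> Q"
  shows "stochastic_subgroup d (qplex_symmetries d Q)"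
proof -
  have "A ** B \<in> qplex_symmetries d Q"
    if "A \<in> qplex_symmetries d Q" "B \<in> qplex_symmetries d Q" for A B
  proof -
    have "(*v) (A ** B) ` Q = (*v) A ` ((*v) B ` Q)"
      by (simp add: image_image matrix_vector_mul_assoc)
    then show ?thesis using that
      by (simp add: qplex_symmetries_def orthogonal_matrix_mul matrix_vector_mul_assoc[symmetric])
  qed
  moreover have "mat 1 \<in> qplex_symmetries d Q"
    by (simp add: qplex_symmetries_def orthogonal_matrix_id)
  moreover have "orthogonal_matrix A" "A *v cvec d = cvec d" if "A \<in> qplex_symmetries d Q" for A
    using that by (simp_all add: qplex_symmetries_def)
  moreover have "matrix_inv A \<in> qplex_symmetries d Q" if "A \<in> qplex_symmetries d Q" for A
  proof -
    have "orthogonal_matrix A" using that by (simp add: qplex_symmetries_def)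
    then show ?thesis
      using transpose_in_qplex_symmetries[OF that] by (simp add: matrix_inv_orthogonal)
  qed
  ultimately show ?thesis
    using qplex_symmetry_entry_ge[OF assms(1,2,3)]
    unfolding stochastic_subgroup_def orth_subgroup_def by (intro conjI ballI allI subsetI) auto
qed

lemma preservation_group_eq_qplex_symmetries:
  assumes card: "CARD('n) = d^2" and d2: "d \<ge> 2" and qplex: "qplex d (Q :: (real^'n) set)"
    and units: "\<And>j. unit_germ d j \<in> Q"
  shows "preservation_group d Q = qplex_symmetries d Q"
proof (intro equalityI subsetI)
  have d: "d > 0" using d2 by simp
  note pres_iff = preservation_group_iff[OF qplex_subset_hypH[OF qplex]]
  fix R assume "R \<in> preservation_group d Q"
  then obtain r where r: "measurement r" "stretched d r = R" and image: "(*v) R ` Q = Q"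
    using pres_iff by blast
  have "unit_germ d i $ i = 1 / real d" for i by (simp add: unit_germ_def)
  then have "\<exists>q\<in>Q. q $ i = 1 / real d" for i using units by blast
  moreover have "span Q = UNIV"
    using span_unit_germs[OF d] span_mono[of "insert (cvec d) (range (unit_germ d))" Q]
      cvec_in_qplex[OF card d qplex] units by auto
  ultimately show "R \<in> qplex_symmetries d Q"
    using qplex_preserving_orthogonal[OF card d2 qplex image] col_sum_stretched[OF card d r(1)] r(2) image
    by (auto simp: qplex_symmetries_def)
next
  have d: "d > 0" using d2 by simp
  fix M assume M: "M \<in> qplex_symmetries d Q"
  then have orth: "orthogonal_matrix M" and fix_c: "M *v cvec d = cvec d" and image: "(*v) M ` Q = Q"
    by (simp_all add: qplex_symmetries_def)
  have "\<exists>r. measurement r \<and> stretched d r = M"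
    using stretched_measurement_exists[OF card d] row_sum_eq_one_if_fixes_cvec[OF d fix_c]
      col_sum_eq_one_if_fixes_cvec[OF d fix_c orth] qplex_symmetry_entry_ge[OF qplex d units M]
    by blast
  then show "M \<in> preservation_group d Q"
    using preservation_group_iff[OF qplex_subset_hypH[OF qplex]] image by blast
qed

lemma stochastic_subgroup_subset_qplex_symmetries:
  assumes "stochastic_subgroup d \<G>" "d > 0"
  shows "\<G> \<subseteq> qplex_symmetries d (closure (convex hull orbital_germ d \<G>))"
proof
  fix R assume "R \<in> \<G>"
  then show "R \<in> qplex_symmetries d (closure (convex hull orbital_germ d \<G>))"
    using stochastic_subgroupD(1,2)[OF assms(1)] closed_hull_orbital_germ_invariant[OF assms]
    by (simp add: qplex_symmetries_def)
qed

lemma orbital_germ_subset_qplex: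
  assumes card: "CARD('n) = d^2" and d: "d > 0" and qplex: "qplex d (Q :: (real^'n) set)"
    and "stochastic_subgroup d \<G>" and maps_into: "\<And>R. R \<in> \<G> \<Longrightarrow> (*v) R ` Q \<subseteq> Q"
  shows "orbital_germ d \<G> \<subseteq> Q"
proof
  fix s assume "s \<in> orbital_germ d \<G>"
  then obtain R i where R: "R \<in> \<G>" and s: "s = (\<chi> j. (real d * R $ i $ j + 1) / (real d * (real d + 1)))"
    by (auto simp: orbital_germ_def)
  have row_sum: "(\<Sum>j\<in>UNIV. R $ i $ j) = 1"
    using row_sum_eq_one_if_fixes_cvec[OF d stochastic_subgroupD(2)[OF assms(4) R]] .
  show "s \<in> Q"
  proof (rule qplex_polarI[OF qplex])
    have "(\<Sum>j\<in>UNIV. s $ j)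
        = (real d * (\<Sum>j\<in>UNIV. R $ i $ j) + real CARD('n)) / (real d * (real d + 1))"
      by (simp add: s sum_divide_distrib[symmetric] sum.distrib sum_distrib_left)
    also have "real d * (\<Sum>j\<in>UNIV. R $ i $ j) + real CARD('n) = real d * (real d + 1)"
      by (simp add: row_sum card power2_eq_square algebra_simps)
    also have "\<dots> / (real d * (real d + 1)) = 1" using d by simp
    finally show "s \<in> hypH" by (simp add: hypH_def)
  next
    fix v assume v: "v \<in> Q"
    have "(R *v v) $ i \<ge> 0" using qplex_nonneg[OF qplex] maps_into[OF R] v by blast
    moreover have "(\<Sum>j\<in>UNIV. v $ j) = 1" using qplex_subset_hypH[OF qplex] v by (auto simp: hypH_def)
    ultimately show "1 / (real d * (real d + 1)) \<le> inner s v"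
      using d by (simp add: s inner_germ divide_right_mono)
  qed
qed

lemma closed_qplex: "qplex d Q \<Longrightarrow> closed Q"
  using closed_qpolar[of d Q] by (simp add: qplex_def)

lemma convex_qplex: "qplex d Q \<Longrightarrow> convex Q"
  using convex_qpolar[of d Q] by (simp add: qplex_def)

lemma qplex_eq_if_subset: "qplex d P \<Longrightarrow> qplex d Q \<Longrightarrow> P \<subseteq> Q \<Longrightarrow> P = Q"
  using qpolar_antimono[of P Q d] by (simp add: qplex_def)

lemma qplex_eq_closed_hull_orbital_germ:
  assumes card: "CARD('n) = d^2" and d: "d > 0" and stochastic: "stochastic_subgroup d \<G>"
    and qplex: "qplex d (closure (convex hull orbital_germ d \<G>))"
    and Q: "qplex d (Q :: (real^'n) set)" and preserves: "\<G> \<subseteq> preservation_group d Q"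
  shows "Q = closure (convex hull orbital_germ d \<G>)"
proof -
  have "orbital_germ d \<G> \<subseteq> Q"
    using orbital_germ_subset_qplex[OF card d Q stochastic]
      preserves preservation_group_iff[OF qplex_subset_hypH[OF Q]] by blast
  then have "closure (convex hull orbital_germ d \<G>) \<subseteq> Q"
    using closed_qplex[OF Q] convex_qplex[OF Q] by (intro closure_minimal hull_minimal) auto
  then show ?thesis using qplex_eq_if_subset[OF qplex Q] by simp
qed

theorem mainTheorem15:
  fixes d :: nat and \<G> :: "(real^'n^'n) set"
  assumes "d \<ge> 2" and "CARD('n) = d^2"
    and "strongly_maximal d \<G>"
  shows "qplex d (closure (convex hull (orbital_germ d \<G>))) \<and>
         \<G> = preservation_group d (closure (convex hull (orbital_germ d \<G>))) \<and>
         (\<forall>Q :: (real^'n) set. qplex d Q \<and> \<G> = preservation_group d Q \<longrightarrow>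
             Q = closure (convex hull (orbital_germ d \<G>)))"
proof -
  define Q\<^sub>0 where "Q\<^sub>0 = closure (convex hull (orbital_germ d \<G>))"
  have d: "d > 0" using assms(1) by simp
  have qplex: "qplex d Q\<^sub>0" and stochastic: "stochastic_subgroup d \<G>"
    and maximal: "\<And>\<G>'. stochastic_subgroup d \<G>' \<Longrightarrow> \<G> \<subseteq> \<G>' \<Longrightarrow> \<G>' = \<G>"
    using assms(3) by (auto simp: strongly_maximal_def maximal_stochastic_def Q\<^sub>0_def)
  have "mat 1 \<in> \<G>" using stochastic by (simp add: stochastic_subgroup_def orth_subgroup_def)
  then have units: "unit_germ d j \<in> Q\<^sub>0" for j
    using unit_germ_in_orbital_germ[OF d] unfolding Q\<^sub>0_def by (meson closure_subset hull_subset subsetD)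
  have "qplex_symmetries d Q\<^sub>0 = \<G>"
    using maximal stochastic_subgroup_qplex_symmetries[OF qplex d units]
      stochastic_subgroup_subset_qplex_symmetries[OF stochastic d] unfolding Q\<^sub>0_def by blast
  then have preservation: "\<G> = preservation_group d Q\<^sub>0"
    using preservation_group_eq_qplex_symmetries[OF assms(2,1) qplex units] by simp
  have "Q = Q\<^sub>0" if "qplex d Q" "\<G> = preservation_group d Q" for Q
    using qplex_eq_closed_hull_orbital_germ[OF assms(2) d stochastic] qplex that
    unfolding Q\<^sub>0_def by blast
  then show ?thesis using qplex preservation unfolding Q\<^sub>0_def by blast
qed

end
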